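(* Let $n\ge3$, $f=\frac1nx^n+xy^2$, $G=\mathbb{Z}/2n\mathbb{Z}=\langle\Lambda\rangle$ with $\rho(\Lambda)=\mathrm{diag}(\zeta_{2n}^2,\zeta_{2n}^{-1})$, $\zeta_{2n}=e^{2\pi i/2n}$, $\sigma\equiv0$, and $j=\Lambda^{n+1}$ (so $\rho(j)=\mathrm{diag}(e^{2\pi i/n},e^{2\pi i(n-1)/2n})$). Then the $\check\varphi$-invariant subspace of $\check{GM_f}$ is spanned by $$\check1_{\Lambda^{-k}}\ (k\in\{0,1,\dots,2n-2\}\setminus\{n-1\}),\qquad y\,\check1_{\Lambda^{-(n-1)}},$$ where $\check 1_{\Lambda^{-k}}$ has dual bi-degree $(-\frac{k}{2n},\frac{k}{2n})$ and $y\check1_{\Lambda^{-(n-1)}}$ has dual bi-degree $(-\frac{n-1}{2n},\frac{n-1}{2n})$. Thus the invariants have dimension $2n-1$ and their bi-degrees are exactly $(-\frac{k}{2n},\frac{k}{2n})$, $k=0,\dots,2n-2$, each occurring once, i.e. the spectrum of the $(a,c)$ realization of the $A_{2n-1}$ Milnor ring $\mathbb{C}[z]/(z^{2n-1})$ with $\deg z=\frac1{2n}$.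
   Context: Standing setup. For quasi-homogeneous $f$ with weights $q_i\in(0,1)$, $d=\sum_i(1-2q_i)$, a finite abelian group $G$ acting diagonally via $\rho$ leaving $f$ invariant, $\rho(g)=\mathrm{diag}(e^{2\pi i\nu_i(g)})$, $\nu_i(g)\in[0,1)$: $\mathrm{Fix}(g)$ is spanned by the coordinates with $\nu_i(g)=0$, $A_g=M_{f|_{\mathrm{Fix}(g)}}$ ($=\mathbb{C}$ if $\mathrm{Fix}(g)=0$) with elements $a1_g$; for $\sigma\in\mathrm{Hom}(G,\mathbb{Z}/2\mathbb{Z})$, $\varphi(h)(a1_g)=(-1)^{\sigma(h)\sigma(g)}\det(\rho(h))^{-1}\det(\rho(h)|_{\mathrm{Fix}(g)})\,a(\rho(h)z)\,1_g$, and $\chi(h)=(-1)^{\sigma(h)}\det\rho(h)$. Let $j\in G$ satisfy $\rho(j)=\mathrm{diag}(e^{2\pi iq_i})$. Dual: $\check A_g:=A_{gj^{-1}}$; $a\check1_g$ denotes $a1_{gj^{-1}}$ viewed in $\check A_g$; $\check\varphi(h)(a\check1_g)=\chi(h)\varphi(h)(a1_{gj^{-1}})$ viewed in $\check A_g$. Shifts $s_g=\sum_{i:\nu_i(g)\ne0}(\nu_i(g)-q_i)$, $\bar s_g=\sum_{i:\nu_i(g)\ne0}(1-\nu_i(g)-q_i)$; dual bi-degree of $a\check1_g$ is $(\deg a+s_{gj^{-1}}-d,\ \deg a+\bar s_{gj^{-1}})$. For $D_{n+1}$: $q_x=\frac1n$, $q_y=\frac{n-1}{2n}$, $d=\frac{n-1}n$,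 $M_f$ has basis $1,x,\dots,x^{n-1},y$. *)

theory Defs
  imports Complex_Main
begin

text \<open>A group element Lambda^m is represented by the residue m mod 2n (a nat < 2n).
  A monomial x^a y^b is represented by the exponent pair (a,b).\<close>

definition zeta :: "nat \<Rightarrow> complex" where
  "zeta n = cis (2 * pi / real (2 * n))"

definition lam_pow :: "nat \<Rightarrow> int \<Rightarrow> nat" where
  "lam_pow n k = nat (k mod int (2 * n))"

definition rho_x :: "nat \<Rightarrow> nat \<Rightarrow> complex" where
  "rho_x n m = zeta n ^ (2 * m)"
definition rho_y :: "nat \<Rightarrow> nat \<Rightarrow> complex" where
  "rho_y n m = inverse (zeta n) ^ m"

text \<open>nu_i(g) in [0,1) with rho_i(g) = exp(2 pi i nu_i(g)).\<close>
definition nu_x :: "nat \<Rightarrow> nat \<Rightarrow> real" where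
  "nu_x n m = frac (real (2 * m) / real (2 * n))"
definition nu_y :: "nat \<Rightarrow> nat \<Rightarrow> real" where
  "nu_y n m = frac (- real m / real (2 * n))"

text \<open>Weights of f = x^n/n + x y^2 and central charge d.\<close>
definition q_x :: "nat \<Rightarrow> real" where "q_x n = 1 / real n"
definition q_y :: "nat \<Rightarrow> real" where "q_y n = (real n - 1) / (2 * real n)"
definition cc :: "nat \<Rightarrow> real" where "cc n = (1 - 2 * q_x n) + (1 - 2 * q_y n)"

text \<open>Monomial basis of A_g = M_{f|Fix(g)}:
  Fix(g) = C^2: M_f has basis 1, x, ..., x^(n-1), y;
  Fix(g) = x-axis: f| = x^n/n, Milnor ring C[x]/(x^(n-1)) with basis 1,...,x^(n-2);
  Fix(g) = 0: A_g = C, basis 1;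
  Fix(g) = y-axis never occurs for this group (left empty).\<close>
definition mbasis :: "nat \<Rightarrow> nat \<Rightarrow> (nat \<times> nat) set" where
  "mbasis n g =
    (if nu_x n g = 0 \<and> nu_y n g = 0 then {(a, 0) | a. a < n} \<union> {(0, 1)}
     else if nu_x n g = 0 then {(a, 0) | a. a < n - 1}
     else if nu_y n g = 0 then {}
     else {(0, 0)})"

definition mdeg :: "nat \<Rightarrow> nat \<times> nat \<Rightarrow> real" where
  "mdeg n mo = real (fst mo) * q_x n + real (snd mo) * q_y n"

definition shift :: "nat \<Rightarrow> nat \<Rightarrow> real" where
  "shift n g = (if nu_x n g \<noteq> 0 then nu_x n g - q_x n else 0)
             + (if nu_y n g \<noteq> 0 then nu_y n g - q_y n else 0)"
definition shiftbar :: "nat \<Rightarrow> nat \<Rightarrow> real" where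
  "shiftbar n g = (if nu_x n g \<noteq> 0 then 1 - nu_x n g - q_x n else 0)
                + (if nu_y n g \<noteq> 0 then 1 - nu_y n g - q_y n else 0)"

definition jel :: "nat \<Rightarrow> nat" where "jel n = lam_pow n (int n + 1)"
definition gjinv :: "nat \<Rightarrow> nat \<Rightarrow> nat" where
  "gjinv n g = lam_pow n (int g - (int n + 1))"

text \<open>The dual state space: families of coefficients v g mo of the basis elements
  mo check-1_g, where mo ranges over the monomial basis of check-A_g = A_{g j^{-1}}.\<close>
definition chk_space :: "nat \<Rightarrow> (nat \<Rightarrow> nat \<times> nat \<Rightarrow> complex) set" where
  "chk_space n = {v. \<forall>g mo. v g mo \<noteq> 0 \<longrightarrow> g < 2 * n \<and> mo \<in> mbasis n (gjinv n g)}"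

definition sigma :: "nat \<Rightarrow> nat \<Rightarrow> nat" where "sigma n h = 0"

definition det_rho :: "nat \<Rightarrow> nat \<Rightarrow> complex" where
  "det_rho n h = rho_x n h * rho_y n h"
definition det_fix :: "nat \<Rightarrow> nat \<Rightarrow> nat \<Rightarrow> complex" where
  "det_fix n h g = (if nu_x n g = 0 then rho_x n h else 1) * (if nu_y n g = 0 then rho_y n h else 1)"

text \<open>phi(h)(x^a y^b 1_g) = coefficient * x^a y^b 1_g.\<close>
definition phi_coef :: "nat \<Rightarrow> nat \<Rightarrow> nat \<Rightarrow> nat \<times> nat \<Rightarrow> complex" where
  "phi_coef n h g mo = (-1) ^ (sigma n h * sigma n g) * inverse (det_rho n h) * det_fix n h g
                       * rho_x n h ^ fst mo * rho_y n h ^ snd mo"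

definition chi :: "nat \<Rightarrow> nat \<Rightarrow> complex" where
  "chi n h = (-1) ^ sigma n h * det_rho n h"

text \<open>check-phi(h)(a check-1_g) = chi(h) phi(h)(a 1_{g j^{-1}}), extended linearly.\<close>
definition check_act :: "nat \<Rightarrow> nat \<Rightarrow> (nat \<Rightarrow> nat \<times> nat \<Rightarrow> complex) \<Rightarrow> (nat \<Rightarrow> nat \<times> nat \<Rightarrow> complex)" where
  "check_act n h v = (\<lambda>g mo. chi n h * phi_coef n h (gjinv n g) mo * v g mo)"

definition invariants :: "nat \<Rightarrow> (nat \<Rightarrow> nat \<times> nat \<Rightarrow> complex) set" where
  "invariants n = {v \<in> chk_space n. \<forall>h < 2 * n. check_act n h v = v}"

definition bvec :: "nat \<Rightarrow> nat \<times> nat \<Rightarrow> (nat \<Rightarrow> nat \<times> nat \<Rightarrow> complex)" where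
  "bvec g mo = (\<lambda>g' mo'. if g' = g \<and> mo' = mo then 1 else 0)"

definition cspan_idx :: "(nat \<times> (nat \<times> nat)) set \<Rightarrow> (nat \<Rightarrow> nat \<times> nat \<Rightarrow> complex) set" where
  "cspan_idx I = {v. \<exists>c. v = (\<lambda>g mo. \<Sum>i\<in>I. c i * bvec (fst i) (snd i) g mo)}"
definition lin_indep_idx :: "(nat \<times> (nat \<times> nat)) set \<Rightarrow> bool" where
  "lin_indep_idx I = (\<forall>c. (\<lambda>g mo. \<Sum>i\<in>I. c i * bvec (fst i) (snd i) g mo) = (\<lambda>_ _. 0)
                         \<longrightarrow> (\<forall>i\<in>I. c i = 0))"

definition dual_bideg :: "nat \<Rightarrow> nat \<times> (nat \<times> nat) \<Rightarrow> real \<times> real" where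
  "dual_bideg n i = (mdeg n (snd i) + shift n (gjinv n (fst i)) - cc n,
                     mdeg n (snd i) + shiftbar n (gjinv n (fst i)))"

end

theory Submission
  imports Defs
begin

(* Since sigma = 0, chi(h) cancels the factor det(rho(h))^-1 of phi(h), so Lambda^h acts on
   x^a y^b check-1_g by the h-th power of a 2n-th root of unity that depends only on the monomial
   and on the sector m = g j^-1; the invariants are spanned by the basis vectors on which Lambda
   acts trivially. In a narrow sector (Fix = 0) the only monomial is 1, with eigenvalue 1; for
   m = n (Fix = x-axis) the eigenvalues zeta^(2a+2), a < n - 1, are nontrivial; in the untwisted
   sector m = 0 the monomial x^a has eigenvalue zeta^(2a+1) and only y survives. For g = Lambda^-k
   the sector is Lambda^-(k+n+1), untwisted exactly for k = n - 1, and in the narrow sectors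
   nu_x + nu_y = 3/2 - (k+1)/2n, which gives the bi-degree (-k/2n, k/2n). *)

lemma zeta_nonzero: "zeta n \<noteq> 0"
  by (simp add: zeta_def)

lemma zeta_pow_eq_1_iff:
  assumes "j < 2 * n"
  shows "zeta n ^ j = 1 \<longleftrightarrow> j = 0"
proof
  assume "zeta n ^ j = 1"
  then have "cis (2 * pi * real j / real (2 * n)) = cis (2 * pi * real 0 / real (2 * n))"
    by (simp add: zeta_def DeMoivre mult_ac)
  moreover have "inj_on (\<lambda>k. cis (2 * pi * real k / real (2 * n))) {..<2 * n}"
    using bij_betw_roots_unity[of "2 * n"] assms by (simp add: bij_betw_def)
  ultimately show "j = 0"
    using assms by (auto simp: inj_on_def)
qed simp

lemma lam_pow_less: "0 < n \<Longrightarrow> lam_pow n k < 2 * n"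
  by (simp add: lam_pow_def nat_less_iff)

lemma gjinv_lam_pow: "0 < n \<Longrightarrow> gjinv n (lam_pow n k) = lam_pow n (k - (int n + 1))"
  by (simp add: gjinv_def lam_pow_def mod_diff_left_eq)

lemma lam_pow_of_nat: "g < 2 * n \<Longrightarrow> lam_pow n (int g) = g"
  by (simp add: lam_pow_def)

lemma lam_pow_neg_lam_pow: "0 < n \<Longrightarrow> lam_pow n (- int (lam_pow n k)) = lam_pow n (- k)"
  by (simp add: lam_pow_def mod_minus_eq)

lemma gjinv_lam_pow_neg:
  assumes "k < 2 * n"
  shows "gjinv n (lam_pow n (- int k)) = (if k < n then n - 1 - k else 3 * n - 1 - k)"
proof -
  have "- int k - (int n + 1) = int (if k < n then n - 1 - k else 3 * n - 1 - k)
          + (if k < n then -1 else -2) * int (2 * n)"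
    using assms by auto
  moreover have "int (if k < n then n - 1 - k else 3 * n - 1 - k) < int (2 * n)"
    using assms by auto
  ultimately have "(- int k - (int n + 1)) mod int (2 * n) = int (if k < n then n - 1 - k else 3 * n - 1 - k)"
    by (metis mod_mult_self1 mod_pos_pos_trivial of_nat_0_le_iff)
  moreover have "0 < n"
    using assms by simp
  ultimately show ?thesis
    unfolding gjinv_lam_pow[OF \<open>0 < n\<close>] by (simp add: lam_pow_def)
qed

lemma nu_x_of_less:
  assumes "m < 2 * n"
  shows "nu_x n m = (if m < n then real m / real n else real m / real n - 1)"
proof -
  have "frac (real m / real n) = (if m < n then real m / real n else real m / real n - 1)"
    using assms by (subst frac_unique_iff) (auto simp: divide_simps)
  then show ?thesis
    by (simp add: nu_x_def)
qed

lemma nu_y_of_less: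
  assumes "m < 2 * n"
  shows "nu_y n m = (if m = 0 then 0 else 1 - real m / real (2 * n))"
proof -
  have "frac (- real m / real (2 * n)) = (if m = 0 then 0 else 1 - real m / real (2 * n))"
    using assms by (subst frac_unique_iff) (auto simp: divide_simps)
  then show ?thesis
    by (simp add: nu_y_def)
qed

lemma nu_x_eq_0_iff: "m < 2 * n \<Longrightarrow> nu_x n m = 0 \<longleftrightarrow> m = 0 \<or> m = n"
  by (auto simp: nu_x_of_less divide_simps)

lemma nu_y_eq_0_iff: "m < 2 * n \<Longrightarrow> nu_y n m = 0 \<longleftrightarrow> m = 0"
  by (auto simp: nu_y_of_less divide_simps)

(* The eigenvalue of check-phi(Lambda) on x^a y^b check-1_g, where m = g j^-1. *)
definition gen_eigenvalue :: "nat \<Rightarrow> nat \<Rightarrow> nat \<times> nat \<Rightarrow> complex" where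
  "gen_eigenvalue n m mo = det_fix n 1 m * rho_x n 1 ^ fst mo * rho_y n 1 ^ snd mo"

lemma check_act_eq_power:
  "check_act n h v = (\<lambda>g mo. gen_eigenvalue n (gjinv n g) mo ^ h * v g mo)"
proof -
  have "rho_x n h = rho_x n 1 ^ h" "rho_y n h = rho_y n 1 ^ h"
    by (simp_all add: rho_x_def rho_y_def flip: power_mult)
  moreover have "det_rho n h \<noteq> 0"
    by (simp add: det_rho_def rho_x_def rho_y_def zeta_nonzero)
  ultimately show ?thesis
    by (simp add: check_act_def chi_def phi_coef_def sigma_def gen_eigenvalue_def det_fix_def
        power_mult_distrib fun_eq_iff power_mult[symmetric] mult.commute)
qed

definition invariant_support :: "nat \<Rightarrow> (nat \<times> (nat \<times> nat)) set" where
  "invariant_support n = {(g, mo). g < 2 * n \<and> mo \<in> mbasis n (gjinv n g)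
                                   \<and> gen_eigenvalue n (gjinv n g) mo = 1}"

lemma invariants_eq_supported:
  assumes "0 < n"
  shows "invariants n = {v. \<forall>g mo. v g mo \<noteq> 0 \<longrightarrow> (g, mo) \<in> invariant_support n}"
proof (intro set_eqI iffI CollectI allI impI)
  fix v g mo
  assume v: "v \<in> invariants n" and nz: "v g mo \<noteq> 0"
  then have "g < 2 * n \<and> mo \<in> mbasis n (gjinv n g)"
    unfolding invariants_def chk_space_def by blast
  moreover have "check_act n 1 v g mo = v g mo"
    using v assms by (simp add: invariants_def)
  ultimately show "(g, mo) \<in> invariant_support n"
    using nz by (simp add: invariant_support_def check_act_eq_power)
next
  fix v :: "nat \<Rightarrow> nat \<times> nat \<Rightarrow> complex"
  assume "v \<in> {v. \<forall>g mo. v g mo \<noteq> 0 \<longrightarrow> (g, mo) \<in> invariant_support n}"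
  then have supp: "v g mo \<noteq> 0 \<Longrightarrow> (g, mo) \<in> invariant_support n" for g mo
    by blast
  then have "gen_eigenvalue n (gjinv n g) mo ^ h * v g mo = v g mo" for h g mo
    by (cases "v g mo = 0") (auto simp: invariant_support_def)
  then have "check_act n h v = v" for h
    unfolding check_act_eq_power by blast
  moreover have "v \<in> chk_space n"
    using supp by (auto simp: chk_space_def invariant_support_def)
  ultimately show "v \<in> invariants n"
    by (simp add: invariants_def)
qed

lemma mbasis_0: "0 < n \<Longrightarrow> mbasis n 0 = {(a, 0) | a. a < n} \<union> {(0, 1)}"
  by (simp add: mbasis_def nu_x_eq_0_iff nu_y_eq_0_iff)

lemma mbasis_n: "0 < n \<Longrightarrow> mbasis n n = {(a, 0) | a. a < n - 1}"
  by (simp add: mbasis_def nu_x_eq_0_iff nu_y_eq_0_iff)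

lemma mbasis_other: "m < 2 * n \<Longrightarrow> m \<noteq> 0 \<Longrightarrow> m \<noteq> n \<Longrightarrow> mbasis n m = {(0, 0)}"
  by (simp add: mbasis_def nu_x_eq_0_iff nu_y_eq_0_iff)

lemma gen_eigenvalue_0: "0 < n \<Longrightarrow> gen_eigenvalue n 0 (a, b) = zeta n ^ (2 * a + 1) * inverse (zeta n) ^ b"
  by (simp add: gen_eigenvalue_def det_fix_def nu_x_eq_0_iff nu_y_eq_0_iff rho_x_def rho_y_def
      power_add power_mult power2_eq_square zeta_nonzero)

lemma gen_eigenvalue_n: "0 < n \<Longrightarrow> gen_eigenvalue n n (a, 0) = zeta n ^ (2 * a + 2)"
  by (simp add: gen_eigenvalue_def det_fix_def nu_x_eq_0_iff nu_y_eq_0_iff rho_x_def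
      power_add power_mult power2_eq_square)

lemma gen_eigenvalue_other:
  "m < 2 * n \<Longrightarrow> m \<noteq> 0 \<Longrightarrow> m \<noteq> n \<Longrightarrow> gen_eigenvalue n m (0, 0) = 1"
  by (simp add: gen_eigenvalue_def det_fix_def nu_x_eq_0_iff nu_y_eq_0_iff)

lemma invariant_monomial_iff:
  assumes "m < 2 * n"
  shows "mo \<in> mbasis n m \<and> gen_eigenvalue n m mo = 1
           \<longleftrightarrow> (if m = 0 then mo = (0, 1) else m \<noteq> n \<and> mo = (0, 0))"
proof -
  have n_pos: "0 < n"
    using assms by simp
  consider "m = 0" | "m = n" | "m \<noteq> 0" "m \<noteq> n"
    by blast
  then show ?thesis
  proof cases
    case 1
    have "gen_eigenvalue n 0 (a, 0) \<noteq> 1" if "a < n" for a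
      using that n_pos zeta_pow_eq_1_iff[of "2 * a + 1" n] by (simp add: gen_eigenvalue_0)
    moreover have "gen_eigenvalue n 0 (0, 1) = 1"
      using n_pos by (simp add: gen_eigenvalue_0 zeta_nonzero)
    ultimately show ?thesis
      using 1 n_pos by (auto simp: mbasis_0)
  next
    case 2
    have "gen_eigenvalue n n (a, 0) \<noteq> 1" if "a < n - 1" for a
      using that n_pos zeta_pow_eq_1_iff[of "2 * a + 2" n] by (simp add: gen_eigenvalue_n)
    then show ?thesis
      using 2 n_pos by (auto simp: mbasis_n)
  next
    case 3
    then show ?thesis
      using assms by (auto simp: mbasis_other gen_eigenvalue_other)
  qed
qed

lemma lam_pow_neg_mem_invariant_support_iff:
  assumes "k < 2 * n"
  shows "(lam_pow n (- int k), mo) \<in> invariant_support n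
           \<longleftrightarrow> k \<noteq> 2 * n - 1 \<and> mo = (if k = n - 1 then (0, 1) else (0, 0))"
proof -
  let ?m = "gjinv n (lam_pow n (- int k))"
  have "?m < 2 * n"
    using assms by (simp add: gjinv_lam_pow lam_pow_less)
  then have "(lam_pow n (- int k), mo) \<in> invariant_support n
               \<longleftrightarrow> (if ?m = 0 then mo = (0, 1) else ?m \<noteq> n \<and> mo = (0, 0))"
    using assms by (simp add: invariant_support_def lam_pow_less invariant_monomial_iff)
  moreover have "?m = 0 \<longleftrightarrow> k = n - 1" and "?m = n \<longleftrightarrow> k = 2 * n - 1"
    using gjinv_lam_pow_neg[OF assms] assms by auto
  ultimately show ?thesis
    using assms by (cases "k = n - 1") simp_all
qed

definition invariant_generator :: "nat \<Rightarrow> nat \<Rightarrow> nat \<times> (nat \<times> nat)" where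
  "invariant_generator n k = (lam_pow n (- int k), if k = n - 1 then (0, 1) else (0, 0))"

lemma invariant_support_eq_image:
  assumes "0 < n"
  shows "invariant_support n = invariant_generator n ` {..2 * n - 2}"
proof (intro set_eqI iffI)
  fix x
  assume x: "x \<in> invariant_support n"
  then obtain g mo where gmo: "x = (g, mo)" "g < 2 * n"
    by (auto simp: invariant_support_def)
  define k where "k = lam_pow n (- int g)"
  have k: "k < 2 * n" and g: "g = lam_pow n (- int k)"
    using assms gmo by (simp_all add: k_def lam_pow_less lam_pow_neg_lam_pow lam_pow_of_nat)
  then have "k \<noteq> 2 * n - 1" and "mo = (if k = n - 1 then (0, 1) else (0, 0))"
    using x gmo lam_pow_neg_mem_invariant_support_iff[OF k] by simp_all
  then show "x \<in> invariant_generator n ` {..2 * n - 2}"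
    using k g gmo by (auto simp: invariant_generator_def image_iff)
next
  fix x
  assume "x \<in> invariant_generator n ` {..2 * n - 2}"
  then obtain k where "k \<le> 2 * n - 2" "x = invariant_generator n k"
    by auto
  then show "x \<in> invariant_support n"
    using assms by (simp add: invariant_generator_def lam_pow_neg_mem_invariant_support_iff)
qed

lemma dual_bideg_untwisted:
  "gjinv n g = 0 \<Longrightarrow> dual_bideg n (g, mo) = (mdeg n mo - cc n, mdeg n mo)"
  by (simp add: dual_bideg_def shift_def shiftbar_def nu_x_def nu_y_def)

lemma dual_bideg_narrow:
  assumes "nu_x n (gjinv n g) \<noteq> 0" "nu_y n (gjinv n g) \<noteq> 0"
  shows "dual_bideg n (g, (0, 0))
           = (nu_x n (gjinv n g) + nu_y n (gjinv n g) + q_x n + q_y n - 2,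
              2 - nu_x n (gjinv n g) - nu_y n (gjinv n g) - q_x n - q_y n)"
  using assms by (simp add: dual_bideg_def shift_def shiftbar_def mdeg_def cc_def)

lemma nu_sum_gjinv_lam_pow_neg:
  assumes "k \<le> 2 * n - 2" "k \<noteq> n - 1"
  defines "m \<equiv> gjinv n (lam_pow n (- int k))"
  shows "nu_x n m + nu_y n m = 3 / 2 - (real k + 1) / real (2 * n)"
    and "nu_x n m \<noteq> 0" and "nu_y n m \<noteq> 0"
proof -
  have "0 < n"
    using assms by (cases n) auto
  have m: "m = (if k < n then n - 1 - k else 3 * n - 1 - k)"
    using assms gjinv_lam_pow_neg[of k n] by simp
  then have "m < 2 * n" "m \<noteq> 0" "m \<noteq> n"
    using assms by auto
  then show "nu_x n m \<noteq> 0" "nu_y n m \<noteq> 0"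
    by (simp_all add: nu_x_eq_0_iff nu_y_eq_0_iff)
  show "nu_x n m + nu_y n m = 3 / 2 - (real k + 1) / real (2 * n)"
  proof (cases "k < n")
    case True
    then have "real m = real n - 1 - real k" and "m < n"
      using m assms by (simp_all add: of_nat_diff)
    then show ?thesis
      using \<open>m < 2 * n\<close> \<open>m \<noteq> 0\<close> \<open>0 < n\<close>
      by (simp add: nu_x_of_less nu_y_of_less field_simps)
  next
    case False
    then have "real m = 3 * real n - 1 - real k" and "\<not> m < n"
      using m assms by (simp_all add: of_nat_diff)
    then show ?thesis
      using \<open>m < 2 * n\<close> \<open>m \<noteq> 0\<close> \<open>0 < n\<close>
      by (simp add: nu_x_of_less nu_y_of_less field_simps)
  qed
qed

lemma dual_bideg_invariant_generator:
  assumes "0 < n" "k \<le> 2 * n - 2"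
  shows "dual_bideg n (invariant_generator n k) = (- real k / real (2 * n), real k / real (2 * n))"
proof (cases "k = n - 1")
  case True
  then have "gjinv n (lam_pow n (- int k)) = 0"
    using assms gjinv_lam_pow_neg[of k n] by simp
  then show ?thesis
    using True assms
    by (simp add: invariant_generator_def dual_bideg_untwisted mdeg_def cc_def q_x_def q_y_def
        of_nat_diff field_simps)
next
  case False
  have "q_x n + q_y n = 1 / 2 + 1 / real (2 * n)"
    using assms by (simp add: q_x_def q_y_def field_simps)
  moreover have "(real k + 1) / real (2 * n) = real k / real (2 * n) + 1 / real (2 * n)"
    by (simp add: add_divide_distrib)
  ultimately show ?thesis
    using False assms nu_sum_gjinv_lam_pow_neg[of k n]
    by (simp add: invariant_generator_def dual_bideg_narrow)
qed

lemma sum_bvec_eq: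
  assumes "finite I"
  shows "(\<lambda>g mo. \<Sum>i\<in>I. c i * bvec (fst i) (snd i) g mo) = (\<lambda>g mo. if (g, mo) \<in> I then c (g, mo) else 0)"
proof (intro ext)
  fix g mo
  have "(\<Sum>i\<in>I. c i * bvec (fst i) (snd i) g mo) = (\<Sum>i\<in>I. if i = (g, mo) then c i else 0)"
    by (intro sum.cong) (auto simp: bvec_def)
  then show "(\<Sum>i\<in>I. c i * bvec (fst i) (snd i) g mo) = (if (g, mo) \<in> I then c (g, mo) else 0)"
    using assms by (simp add: sum.delta')
qed

lemma cspan_idx_eq_supported:
  assumes "finite I"
  shows "cspan_idx I = {v. \<forall>g mo. v g mo \<noteq> 0 \<longrightarrow> (g, mo) \<in> I}"
proof (intro set_eqI iffI)
  fix v
  assume "v \<in> cspan_idx I"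
  then show "v \<in> {v. \<forall>g mo. v g mo \<noteq> 0 \<longrightarrow> (g, mo) \<in> I}"
    by (auto simp: cspan_idx_def sum_bvec_eq[OF assms] split: if_splits)
next
  fix v :: "nat \<Rightarrow> nat \<times> nat \<Rightarrow> complex"
  assume "v \<in> {v. \<forall>g mo. v g mo \<noteq> 0 \<longrightarrow> (g, mo) \<in> I}"
  then have "v = (\<lambda>g mo. \<Sum>i\<in>I. v (fst i) (snd i) * bvec (fst i) (snd i) g mo)"
    unfolding sum_bvec_eq[OF assms] by (auto simp: fun_eq_iff)
  then show "v \<in> cspan_idx I"
    unfolding cspan_idx_def by (intro CollectI exI[of _ "\<lambda>i. v (fst i) (snd i)"])
qed

lemma lin_indep_idx_finite: "finite I \<Longrightarrow> lin_indep_idx I"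
  unfolding lin_indep_idx_def by (auto simp: sum_bvec_eq fun_eq_iff)

theorem mainTheorem8:
  fixes n :: nat
  assumes "n \<ge> 3"
  defines "I \<equiv> {(lam_pow n (- int k), (0::nat, 0::nat)) | k. k \<le> 2 * n - 2 \<and> k \<noteq> n - 1}
               \<union> {(lam_pow n (- (int n - 1)), (0, 1))}"
  shows "invariants n = cspan_idx I
    \<and> finite I \<and> card I = 2 * n - 1 \<and> lin_indep_idx I
    \<and> (\<forall>k. k \<le> 2 * n - 2 \<and> k \<noteq> n - 1 \<longrightarrow>
           dual_bideg n (lam_pow n (- int k), (0, 0)) = (- real k / real (2 * n), real k / real (2 * n)))
    \<and> dual_bideg n (lam_pow n (- (int n - 1)), (0, 1))
           = (- (real n - 1) / real (2 * n), (real n - 1) / real (2 * n))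
    \<and> dual_bideg n ` I = {(- real k / real (2 * n), real k / real (2 * n)) | k. k \<le> 2 * n - 2}
    \<and> inj_on (dual_bideg n) I"
proof -
  have n_pos: "0 < n"
    using assms by simp
  let ?K = "{..2 * n - 2}" and ?e = "invariant_generator n"
  have "?e ` ?K = ?e ` (?K - {n - 1}) \<union> {?e (n - 1)}"
    by auto
  also have "?e ` (?K - {n - 1}) = {(lam_pow n (- int k), (0, 0)) | k. k \<le> 2 * n - 2 \<and> k \<noteq> n - 1}"
    by (auto simp: invariant_generator_def)
  also have "?e (n - 1) = (lam_pow n (- (int n - 1)), (0, 1))"
    using n_pos by (simp add: invariant_generator_def of_nat_diff)
  finally have I: "I = ?e ` ?K"
    by (simp add: I_def)
  have bideg: "dual_bideg n (?e k) = (- real k / real (2 * n), real k / real (2 * n))" if "k \<in> ?K" for k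
    using n_pos that by (simp add: dual_bideg_invariant_generator)
  have "inj_on (dual_bideg n \<circ> ?e) ?K"
    using n_pos by (intro inj_onI) (simp add: bideg)
  then have inj_e: "inj_on ?e ?K" and inj_bideg: "inj_on (dual_bideg n) I"
    unfolding I by (simp_all add: inj_on_imageI2 inj_on_imageI)
  have fin: "finite I"
    by (simp add: I)
  have "card I = 2 * n - 1"
    unfolding I card_image[OF inj_e] using n_pos by simp
  moreover have "invariants n = cspan_idx I"
    using invariants_eq_supported[OF n_pos] invariant_support_eq_image[OF n_pos] cspan_idx_eq_supported[OF fin] I
    by simp
  moreover have "dual_bideg n ` I = (\<lambda>k. (- real k / real (2 * n), real k / real (2 * n))) ` ?K"
    unfolding I image_image using bideg by (rule image_cong[OF refl])
  moreover have "dual_bideg n (lam_pow n (- int k), (0, 0)) = (- real k / real (2 * n), real k / real (2 * n))"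
    if "k \<le> 2 * n - 2" "k \<noteq> n - 1" for k
    using bideg[of k] that by (simp add: invariant_generator_def)
  moreover have "dual_bideg n (lam_pow n (- (int n - 1)), (0, 1))
                   = (- (real n - 1) / real (2 * n), (real n - 1) / real (2 * n))"
    using bideg[of "n - 1"] n_pos by (simp add: invariant_generator_def of_nat_diff)
  ultimately show ?thesis
    using fin inj_bideg lin_indep_idx_finite[OF fin] by blast
qed

end
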